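(* For all integers $t\ge 1$, $d\ge 2$, $k\ge 4$ and $n\in\{4dk+6t-11,\;4dk+6t-14\}$ such that $|C|\ge d$ (that is, $d\le 2t+1$ if $n$ is even and $d\le 2t+2$ if $n$ is odd), the set $S^{(n)}_{t,d,k}$ is a symmetric complete sum-free subset of $\mathbb{Z}_n$.
   Context: $\mathbb{Z}_n$ is the cyclic group of integers modulo $n$. For a subset $S$ of an abelian additive group $G$, $S+S=\{x+y \mid x,y\in S\}$, $-S=\{-x \mid x\in S\}$ and $\pm S=S\cup(-S)$. The set $S$ is symmetric if $S=-S$, complete if every $z\in G\setminus S$ satisfies $z\in S+S$, and sum-free if $S\cap(S+S)=\emptyset$. For integers $a\le b$, $[a,b]$ denotes the set of integers $z$ with $a\le z\le b$, also viewed as a subset of $\mathbb{Z}_n$ by reducing modulo $n$. For integers $t\ge 1$, $d\ge 2$, $k\ge 4$ and $n\in\{4dk+6t-11,\;4dk+6t-14\}$, define the following subsets of $\mathbb{Z}_n$ (note that $\frac12(\lceil n/2\rceil+t+1)$ is an integer): $A=\left[\frac12\left(\lceil\frac n2\rceil+t+1\right),\ \frac12\left(\lceil\frac n2\rceil+t+1\right)+d-2\right]$, $B=\left\{\frac12\left(\lceil\frac n2\rceil+t+1\right)+2d-2+i\cdot d \;\middle|\; 0\le i\le k-4\right\}$ ($i$ integer), $C=\left[\lfloor\frac n2\rfloor-t,\ \lceil\frac n2\rceil+t\right]$, and $S^{(n)}_{t,d,k}=(\pm A)\cup(\pm B)\cup C$. *)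

theory Defs
  imports Complex_Main "HOL-Algebra.Elementary_Groups"
begin

(* Groups are written multiplicatively in HOL-Algebra: "S <#> S" is the sumset S + S
   and "set_inv S" is -S. *)

definition symmetric_subset :: "('a, 'b) monoid_scheme \<Rightarrow> 'a set \<Rightarrow> bool" where
  "symmetric_subset G S \<longleftrightarrow> S = set_inv\<^bsub>G\<^esub> S"

definition complete_subset :: "('a, 'b) monoid_scheme \<Rightarrow> 'a set \<Rightarrow> bool" where
  "complete_subset G S \<longleftrightarrow> (\<forall>z \<in> carrier G - S. z \<in> S <#>\<^bsub>G\<^esub> S)"

definition sum_free :: "('a, 'b) monoid_scheme \<Rightarrow> 'a set \<Rightarrow> bool" where
  "sum_free G S \<longleftrightarrow> S \<inter> (S <#>\<^bsub>G\<^esub> S) = {}"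

definition plus_minus :: "('a, 'b) monoid_scheme \<Rightarrow> 'a set \<Rightarrow> 'a set" where
  "plus_minus G S = S \<union> set_inv\<^bsub>G\<^esub> S"

(* The image in Z_n of a set of integers; Z_n is "integer_mod_group n", whose carrier
   for n > 0 is the set of representatives {0..<int n}. *)
definition reduce_mod :: "nat \<Rightarrow> int set \<Rightarrow> int set" where
  "reduce_mod n X = (\<lambda>z. z mod int n) ` X"

(* The division is exact for the values of n under consideration, see even_double_start. *)
definition start :: "nat \<Rightarrow> int \<Rightarrow> int" where
  "start n t = (\<lceil>real n / 2\<rceil> + t + 1) div 2"

definition set_A :: "nat \<Rightarrow> int \<Rightarrow> int \<Rightarrow> int set" where
  "set_A n t d = reduce_mod n {start n t .. start n t + d - 2}"

definition set_B :: "nat \<Rightarrow> int \<Rightarrow> int \<Rightarrow> int \<Rightarrow> int set" where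
  "set_B n t d k = reduce_mod n {start n t + 2 * d - 2 + i * d | i. 0 \<le> i \<and> i \<le> k - 4}"

definition set_C :: "nat \<Rightarrow> int \<Rightarrow> int set" where
  "set_C n t = reduce_mod n {\<lfloor>real n / 2\<rfloor> - t .. \<lceil>real n / 2\<rceil> + t}"

definition set_S :: "nat \<Rightarrow> int \<Rightarrow> int \<Rightarrow> int \<Rightarrow> int set" where
  "set_S n t d k =
     plus_minus (integer_mod_group n) (set_A n t d) \<union>
     plus_minus (integer_mod_group n) (set_B n t d k) \<union>
     set_C n t"

lemma floor_half: "\<lfloor>real n / 2\<rfloor> = int n div 2"
  using floor_divide_of_nat_eq[of n 2, where ?'a = real] by (simp add: zdiv_int)

lemma ceiling_half: "\<lceil>real n / 2\<rceil> = (int n + 1) div 2"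
proof -
  have "\<lceil>real n / 2\<rceil> = - (- int n div 2)"
    using ceiling_divide_eq_div[of "int n" 2, where ?'a = real] by simp
  then show ?thesis by presburger
qed

lemma even_double_start:
  fixes t d k :: int and n :: nat
  assumes "int n \<in> {4 * d * k + 6 * t - 11, 4 * d * k + 6 * t - 14}"
  shows "even (\<lceil>real n / 2\<rceil> + t + 1)"
proof -
  define m where "m = d * k"
  have "int n = 4 * m + 6 * t - 11 \<or> int n = 4 * m + 6 * t - 14"
    using assms by (auto simp: m_def)
  then show ?thesis unfolding ceiling_half by presburger
qed

lemma card_set_C:
  fixes t d k :: int and n :: nat
  assumes "t \<ge> 1" "d \<ge> 2" "k \<ge> 4"
    and "int n \<in> {4 * d * k + 6 * t - 11, 4 * d * k + 6 * t - 14}"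
  shows "int (card (set_C n t)) = (if even n then 2 * t + 1 else 2 * t + 2)"
proof -
  have "2 * 4 \<le> d * k" using assms by (intro mult_mono) auto
  then have n: "2 * t + 2 \<le> int n" using assms by auto
  let ?I = "{\<lfloor>real n / 2\<rfloor> - t .. \<lceil>real n / 2\<rceil> + t}"
  have len: "\<lceil>real n / 2\<rceil> - \<lfloor>real n / 2\<rfloor> = (if even n then 0 else 1)"
    unfolding floor_half ceiling_half by (cases "even n") (presburger | simp)+
  have "inj_on (\<lambda>z. z mod int n) ?I"
  proof (rule inj_onI)
    fix x y assume xy: "x \<in> ?I" "y \<in> ?I" "x mod int n = y mod int n"
    then have "int n dvd x - y" by (simp add: mod_eq_dvd_iff)
    moreover have "\<bar>x - y\<bar> < int n" using xy n len by (auto split: if_splits)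
    ultimately show "x = y" using zdvd_imp_le[of "int n" "\<bar>x - y\<bar>"] by force
  qed
  then have "card (set_C n t) = card ?I"
    unfolding set_C_def reduce_mod_def by (rule card_image)
  then show ?thesis using len assms(1) by (auto split: if_splits)
qed

end

theory Submission
  imports Defs
begin

text \<open>
  Write \<open>w\<close> for the size of \<open>C\<close> and \<open>a\<close> for the left endpoint of \<open>A\<close>. Both families of
  moduli then collapse into one: \<open>a = k d + w - 4\<close>, \<open>n = 4 a - w - 1\<close> and
  \<open>C = [2 a - w, 2 a - 1]\<close>, whatever the parity of \<open>n\<close>. Moreover \<open>A \<union> B = (a - 2) + K\<close> with
  the skeleton \<open>K = [2, d] \<union> {2 d, 3 d, \<dots>, (k - 2) d}\<close>, and the reflection \<open>x \<mapsto> n - x\<close> carries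
  this part to \<open>(2 a - 3) + (k d - K)\<close>, where
  \<open>k d - K = {2 d, \<dots>, (k - 2) d} \<union> [(k - 1) d, k d - 2]\<close>. All of \<open>S\<close> lies in \<open>[a, n - a]\<close>.

  A sum of two elements of \<open>A \<union> B\<close> is \<open>(2 a - 3) + (s + s' - 1)\<close> with \<open>s\<close>, \<open>s'\<close> in \<open>K\<close>. The
  numbers \<open>s + s' - 1\<close> are those of \<open>[3, 2 d - 1]\<close>, those lying strictly between
  \<open>q d\<close> and \<open>(q + 1) d\<close> for some \<open>2 \<le> q \<le> k - 2\<close>, and numbers congruent to \<open>-1\<close> modulo \<open>d\<close>. So they avoid \<open>k d - K\<close>
  (lemma \<open>skeleton_sum_avoids_mirror\<close>), yet fill every gap of \<open>k d - K\<close> in \<open>[3, k d - 2]\<close>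
  (lemma \<open>skeleton_sums_fill_gaps\<close>).

  Sum-freeness: by symmetry, a violation modulo \<open>n\<close> can be turned into an equation \<open>x + y = z\<close>
  between representatives. As \<open>z \<le> n - a\<close>, both summands are smaller than \<open>2 a - w\<close>, hence in
  \<open>A \<union> B\<close>, while \<open>z \<ge> 2 a\<close> lies beyond \<open>C\<close>, hence in \<open>-(A \<union> B)\<close>; the first lemma excludes this.

  Completeness: by symmetry it suffices to reach the residues up to the end of \<open>C\<close>. Those in
  \<open>[a, 2 a - w)\<close> outside \<open>S\<close> are minus a sum of two elements of \<open>A \<union> B\<close> by the second lemma.
  Those below \<open>a\<close> are differences of elements of \<open>S\<close>: \<open>C - C\<close> gives \<open>[0, w - 1]\<close>, \<open>B - A\<close> gives
  \<open>[d, 2 d - 2]\<close>, and \<open>C - (A \<union> B)\<close> gives \<open>[2 d - 2, a - 1]\<close>, because the steps in \<open>K\<close> have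
  length at most \<open>d\<close>. The hypothesis \<open>w \<ge> d\<close> enters twice here: it joins \<open>[0, w - 1]\<close> to
  \<open>[d, 2 d - 2]\<close>, and it lets the translates of \<open>C\<close> in \<open>C - (A \<union> B)\<close> overlap or abut.
\<close>

section \<open>The skeleton of \<open>A \<union> B\<close>\<close>

definition skeleton :: "int \<Rightarrow> int \<Rightarrow> int set" where
  "skeleton d k = {2..d} \<union> (\<lambda>q. q * d) ` {2..k - 2}"

lemma not_multiple_between:
  fixes q r d j :: int
  assumes "0 < r" and "r < d"
  shows "q * d + r \<noteq> j * d"
proof
  assume "q * d + r = j * d"
  then have "(q * d + r) mod d = j * d mod d" by simp
  with assms show False by simp
qed

lemma skeleton_bounds:
  assumes "d \<ge> 2" and "k \<ge> 4" and "s \<in> skeleton d k"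
  shows "2 \<le> s" and "s \<le> k * d - 2 * d"
proof -
  have *: "2 * d \<le> q * d \<and> q * d \<le> k * d - 2 * d" if "q \<in> {2..k - 2}" for q
    using that assms mult_right_mono[of 2 q d] mult_right_mono[of q "k - 2" d]
    by (auto simp: left_diff_distrib)
  have **: "2 * d \<le> k * d - 2 * d" using *[of 2] assms by simp
  from assms(3) consider "2 \<le> s" "s \<le> d" | q where "q \<in> {2..k - 2}" "s = q * d"
    unfolding skeleton_def by auto
  then have "2 \<le> s \<and> s \<le> k * d - 2 * d"
  proof cases
    case 1 then show ?thesis using ** assms(1) by linarith
  next
    case 2 then show ?thesis using *[of q] assms(1) by linarith
  qed
  then show "2 \<le> s" and "s \<le> k * d - 2 * d" by simp_all
qed

lemma mirror_skeleton_iff: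
  "k * d - u \<in> skeleton d k \<longleftrightarrow> k * d - d \<le> u \<and> u \<le> k * d - 2 \<or> (\<exists>q\<in>{2..k - 2}. u = q * d)"
proof -
  have "(\<exists>q\<in>{2..k - 2}. k * d - u = q * d) \<longleftrightarrow> (\<exists>q\<in>{2..k - 2}. u = q * d)"
  proof safe
    fix q assume "q \<in> {2..k - 2}" "k * d - u = q * d"
    then show "\<exists>q\<in>{2..k - 2}. u = q * d"
      by (intro bexI[of _ "k - q"]) (auto simp: algebra_simps)
  next
    fix q assume "q \<in> {2..k - 2}"
    then show "\<exists>p\<in>{2..k - 2}. k * d - q * d = p * d"
      by (intro bexI[of _ "k - q"]) (auto simp: algebra_simps)
  qed
  then show ?thesis unfolding skeleton_def by auto
qed

text \<open>
  Call the elements of \<open>[2, d]\<close> short and the multiples of \<open>d\<close> long. For two short elements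
  \<open>s + s' - 1\<close> stays below \<open>2 d\<close>, where the mirrored skeleton begins. For a short and a long one
  it lies strictly between two multiples of \<open>d\<close>, and below the last block \<open>[(k - 1) d, k d - 2]\<close>.
  For two long ones it is congruent to \<open>-1\<close> modulo \<open>d\<close>, the one residue class that the last block
  omits.
\<close>

lemma skeleton_sum_avoids_mirror:
  assumes d: "d \<ge> 2" and k: "k \<ge> 4" and s: "s \<in> skeleton d k" and s': "s' \<in> skeleton d k"
  shows "k * d - (s + s' - 1) \<notin> skeleton d k"
proof
  assume "k * d - (s + s' - 1) \<in> skeleton d k"
  then consider "k * d - d \<le> s + s' - 1" "s + s' - 1 \<le> k * d - 2"
    | j where "2 \<le> j" "s + s' - 1 = j * d"
    unfolding mirror_skeleton_iff by auto
  note target = this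
  have kd: "4 * d \<le> k * d" using d k by (intro mult_right_mono) auto
  have mixed: False
    if x: "2 \<le> x" "x \<le> d" and y: "y = q * d" "q \<le> k - 2" and sum: "s + s' = x + y" for x y q
  proof -
    have "q * d \<le> (k - 2) * d" using y d by (intro mult_right_mono) auto
    then have "x + y \<le> k * d - d" using x y by (simp add: left_diff_distrib)
    with target show False
    proof cases
      case 2
      then have "q * d + (x - 1) = j * d" using y sum by simp
      then show False using not_multiple_between[of "x - 1" d q j] x by simp
    qed (use sum in simp)
  qed
  from s s' consider
      (short) "s \<le> d" "s' \<le> d"
    | (left) q where "2 \<le> s" "s \<le> d" "s' = q * d" "q \<le> k - 2"
    | (right) q where "2 \<le> s'" "s' \<le> d" "s = q * d" "q \<le> k - 2"
    | (long) q q' where "s = q * d" "s' = q' * d"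
    unfolding skeleton_def by auto
  then show False
  proof cases
    case short
    from target show False
    proof cases
      case 2
      then have "2 * d \<le> j * d" using d by (intro mult_right_mono) auto
      with 2 short show False by simp
    qed (use short kd d in simp)
  next
    case left then show False using mixed[of s s' q] by simp
  next
    case right then show False using mixed[of s' s q] by simp
  next
    case long
    from target show False
    proof cases
      case 1
      then have *: "(k - 1) * d < (q + q') * d" "(q + q') * d < k * d"
        using long by (auto simp: algebra_simps)
      then have "k - 1 < q + q'" "q + q' < k" using d mult_less_cancel_right_pos by auto
      then show False by simp
    next
      case 2
      then have "j * d + 1 = (q + q') * d" using long by (simp add: algebra_simps)
      then show False using not_multiple_between[of 1 d j "q + q'"] d by simp
    qed
  qed
qed

lemma skeleton_sums_fill_gaps:
  assumes d: "d \<ge> 2" and k: "k \<ge> 4" and u: "3 \<le> u" "u \<le> k * d - 2"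
    and gap: "k * d - u \<notin> skeleton d k"
  obtains s s' where "s \<in> skeleton d k" "s' \<in> skeleton d k" "u = s + s' - 1"
proof (cases "u < 2 * d")
  case True
  show thesis
  proof (rule that)
    show "min d (u - 1) \<in> skeleton d k" "u + 1 - min d (u - 1) \<in> skeleton d k"
      using True u d by (auto simp: skeleton_def)
  qed simp
next
  case False
  define q r where "q = u div d" and "r = u mod d"
  have u_eq: "u = q * d + r" and r: "0 \<le> r" "r < d" using d by (auto simp: q_def r_def)
  have "2 \<le> q" using False d zdiv_mono1[of "2 * d" u d] by (simp add: q_def)
  moreover have "q \<le> k - 2"
  proof -
    have "u < k * d - d" using gap u by (auto simp: mirror_skeleton_iff)
    then have "q * d < (k - 1) * d" using u_eq r by (simp add: left_diff_distrib)
    then show ?thesis using d mult_less_cancel_right_pos[of d q "k - 1"] by simp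
  qed
  ultimately have q: "q \<in> {2..k - 2}" by simp
  then have "r \<noteq> 0" using gap u_eq by (auto simp: mirror_skeleton_iff)
  then have "r + 1 \<in> skeleton d k" "q * d \<in> skeleton d k"
    using q r by (auto simp: skeleton_def)
  then show thesis using that u_eq by (metis add.commute add_diff_cancel_right' add.assoc)
qed

text \<open>
  Any window of \<open>w \<ge> d\<close> consecutive integers that meets the range of the skeleton contains one of
  its elements, as consecutive elements differ by at most \<open>d\<close>.
\<close>

lemma skeleton_dense:
  assumes d: "d \<ge> 2" and k: "k \<ge> 4" and w: "d \<le> w" and u: "2 \<le> u" "u < (k - 2) * d + w"
  obtains s where "s \<in> skeleton d k" "u - w < s" "s \<le> u"
proof -
  consider "u \<le> d" | "d < u" "u < 2 * d" | "2 * d \<le> u" by linarith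
  then show thesis
  proof cases
    case 1
    then show thesis using that[of u] u w d by (simp add: skeleton_def)
  next
    case 2
    then show thesis using that[of d] w d by (simp add: skeleton_def)
  next
    case 3
    define q where "q = min (u div d) (k - 2)"
    have "2 \<le> u div d" using 3 d zdiv_mono1[of "2 * d" u d] by simp
    then have "q \<in> {2..k - 2}" using k by (simp add: q_def)
    then have "q * d \<in> skeleton d k" by (auto simp: skeleton_def)
    moreover have "u - d < u div d * d" "u div d * d \<le> u"
      using d div_mult_mod_eq[of u d] pos_mod_bound[of d u] pos_mod_sign[of d u] by linarith+
    moreover have "q * d \<le> u div d * d" using d by (intro mult_right_mono) (auto simp: q_def)
    moreover have "q * d = u div d * d \<or> q * d = (k - 2) * d" by (auto simp: q_def)
    ultimately show thesis using that[of "q * d"] w u by linarith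
  qed
qed

section \<open>The set of representatives\<close>

locale skeleton_set =
  fixes d k w a N :: int
  assumes d: "d \<ge> 2" and k: "k \<ge> 4" and w: "d \<le> w"
    and a: "a = k * d + w - 4" and N: "N = 4 * a - w - 1"
begin

definition left_part :: "int set" where
  "left_part = {x. x - (a - 2) \<in> skeleton d k}"

definition middle :: "int set" where
  "middle = {2 * a - w..2 * a - 1}"

definition reps :: "int set" where
  "reps = {x. x \<in> left_part \<or> x \<in> middle \<or> N - x \<in> left_part}"

lemma kd: "4 * d \<le> k * d"
  using d k by (intro mult_right_mono) auto

lemma a_pos: "0 < a"
  using a kd d w by linarith

lemma left_part_bounds:
  assumes "x \<in> left_part"
  shows "a \<le> x" and "x < 2 * a - w"
proof -
  have "x - (a - 2) \<in> skeleton d k" using assms by (simp add: left_part_def)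
  from skeleton_bounds[OF d k this] show "a \<le> x" "x < 2 * a - w" using a d by linarith+
qed

lemma reps_bounds:
  assumes "x \<in> reps"
  shows "a \<le> x" and "x \<le> N - a"
proof -
  have "a \<le> x \<and> x \<le> N - a"
    if "x \<in> left_part \<or> (2 * a - w \<le> x \<and> x \<le> 2 * a - 1) \<or> N - x \<in> left_part"
    using that left_part_bounds[of x] left_part_bounds[of "N - x"] a N kd d w by linarith
  then show "a \<le> x" "x \<le> N - a" using assms unfolding reps_def middle_def by auto
qed

lemma reps_subset: "reps \<subseteq> {0<..<N}"
  using reps_bounds a_pos by fastforce

lemma reps_reflect: "N - x \<in> reps \<longleftrightarrow> x \<in> reps"
  unfolding reps_def middle_def by (auto simp: N)

lemma reflected_left_part_iff:
  "N - x \<in> left_part \<longleftrightarrow> k * d - (x - (2 * a - 3)) \<in> skeleton d k"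
proof -
  have "N - x - (a - 2) = k * d - (x - (2 * a - 3))" using N a by simp
  then show ?thesis by (simp only: left_part_def mem_Collect_eq)
qed

text \<open>
  Since the sum is at most \<open>N - a\<close> and each summand at least \<open>a\<close>, both summands lie left of the
  middle block; since the sum is at least \<open>2 a\<close>, it lies right of that block.
\<close>

lemma reps_sum_free:
  assumes "x \<in> reps" and "y \<in> reps"
  shows "x + y \<notin> reps"
proof
  assume xy: "x + y \<in> reps"
  have far: "\<not> z < 2 * a - w" if "N - z \<in> left_part" for z
    using left_part_bounds[OF that] N w d by linarith
  have "x < 2 * a - w" "y < 2 * a - w"
    using reps_bounds[OF xy] reps_bounds assms N by fastforce+
  then have "x \<in> left_part" "y \<in> left_part"
    using assms far unfolding reps_def middle_def by auto
  then have "k * d - (x + y - (2 * a - 3)) \<notin> skeleton d k"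
    using skeleton_sum_avoids_mirror[OF d k, of "x - (a - 2)" "y - (a - 2)"]
    unfolding left_part_def by (simp add: algebra_simps)
  moreover have "N - (x + y) \<in> left_part"
  proof -
    have "2 * a \<le> x + y" using assms[THEN reps_bounds(1)] by linarith
    then show ?thesis
      using xy left_part_bounds[of "x + y"] w d unfolding reps_def middle_def by auto
  qed
  ultimately show False by (simp add: reflected_left_part_iff)
qed

text \<open>
  Differences within the middle block give \<open>[0, w - 1]\<close>. For \<open>z \<ge> 2 d - 2\<close> the translates of the
  middle block by minus the left part leave no hole. If \<open>w < 2 d - 2\<close>, a stretch between these
  ranges remains, covered by subtracting short elements of the skeleton from \<open>2 d\<close>.
\<close>

lemma small_residue_is_difference:
  assumes z: "0 \<le> z" "z < a"
  obtains x y where "x \<in> reps" "y \<in> reps" "z = x - y"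
proof -
  consider "z < w" | "d \<le> z" "z \<le> 2 * d - 3" | "w \<le> z" "2 * d - 2 \<le> z" using w by linarith
  then show thesis
  proof cases
    case 1
    then have "2 * a - w + z \<in> reps" "2 * a - w \<in> reps"
      using z unfolding reps_def middle_def by auto
    then show thesis using that by fastforce
  next
    case 2
    have "2 * d \<in> skeleton d k" "2 * d - z \<in> skeleton d k"
      using 2 k unfolding skeleton_def by auto
    then have "a - 2 + 2 * d \<in> reps" "a - 2 + (2 * d - z) \<in> reps"
      unfolding reps_def left_part_def by auto
    then show thesis using that by fastforce
  next
    case 3
    \<comment> \<open>The window asks for an \<open>s\<close> in the skeleton with \<open>z + (a - 2 + s)\<close> in the middle block.\<close>
    have "2 \<le> a + 1 - z" "a + 1 - z < (k - 2) * d + w"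
      using 3 z a by (auto simp: left_diff_distrib)
    then obtain s where s: "s \<in> skeleton d k" "a + 1 - z - w < s" "s \<le> a + 1 - z"
      using skeleton_dense[OF d k w] by blast
    then have "z + (a - 2 + s) \<in> reps" "a - 2 + s \<in> reps"
      unfolding reps_def left_part_def middle_def by auto
    then show thesis using that by fastforce
  qed
qed

lemma large_gap_is_sum:
  assumes z: "2 * a \<le> z" "z \<le> N - a" "z \<notin> reps"
  obtains x y where "x \<in> reps" "y \<in> reps" "z = x + y"
proof -
  have "k * d - (z - (2 * a - 3)) \<notin> skeleton d k"
    using z unfolding reps_def by (simp add: reflected_left_part_iff)
  moreover have "3 \<le> z - (2 * a - 3)" "z - (2 * a - 3) \<le> k * d - 2" using z N a by auto
  ultimately obtain s s' where s: "s \<in> skeleton d k" "s' \<in> skeleton d k"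
      and "z - (2 * a - 3) = s + s' - 1"
    using skeleton_sums_fill_gaps[OF d k] by blast
  then have "z = (a - 2 + s) + (a - 2 + s')" by simp
  moreover have "a - 2 + s \<in> reps" "a - 2 + s' \<in> reps"
    using s unfolding reps_def left_part_def by auto
  ultimately show thesis using that by blast
qed

text \<open>
  Replacing summands \<open>x\<close> by \<open>N - x\<close> turns a representation of \<open>z\<close> modulo \<open>N\<close> into one of
  \<open>N - z\<close>. So the two preceding lemmas also cover the residues above \<open>N - a\<close> and the gaps between
  \<open>a\<close> and the middle block.
\<close>

lemma reps_complete:
  assumes z: "0 \<le> z" "z < N" "z \<notin> reps"
  obtains x y where "x \<in> reps" "y \<in> reps" "z = x + y \<or> z = x + y - N"
proof -
  consider "z < a" | "N - a < z" | "2 * a \<le> z" "z \<le> N - a"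
    | "a \<le> z" "z < 2 * a - w" | "z \<in> middle"
    unfolding middle_def by force
  then show thesis
  proof cases
    case 1
    then obtain x y where "x \<in> reps" "y \<in> reps" "z = x - y"
      using small_residue_is_difference z by blast
    then show thesis using that[of x "N - y"] reps_reflect by simp
  next
    case 2
    then obtain x y where "x \<in> reps" "y \<in> reps" "N - z = x - y"
      using small_residue_is_difference[of "N - z"] z by auto
    then show thesis using that[of "N - x" y] reps_reflect by simp
  next
    case 3
    then show thesis using large_gap_is_sum z that by blast
  next
    case 4
    then have "2 * a \<le> N - z" "N - z \<le> N - a" using N by auto
    then obtain x y where "x \<in> reps" "y \<in> reps" "N - z = x + y"
      using large_gap_is_sum[of "N - z"] z reps_reflect by blast
    then show thesis using that[of "N - x" "N - y"] reps_reflect by simp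
  next
    case 5
    then show thesis using z unfolding reps_def by simp
  qed
qed

end

section \<open>Transfer to the cyclic group\<close>

lemma reduce_mod_id:
  assumes "X \<subseteq> {0<..<int n}"
  shows "reduce_mod n X = X"
  using assms unfolding reduce_mod_def by (force simp: image_iff mod_pos_pos_trivial)

lemma set_inv_integer_mod_group:
  assumes "X \<subseteq> {0<..<int n}"
  shows "set_inv\<^bsub>integer_mod_group n\<^esub> X = {x. int n - x \<in> X}"
proof -
  have inv: "inv\<^bsub>integer_mod_group n\<^esub> x = int n - x" if "x \<in> X" for x
  proof -
    have "0 < x" "x < int n" using that assms by auto
    then show ?thesis
      by (simp add: carrier_integer_mod_group zmod_zminus1_eq_if mod_pos_pos_trivial)
  qed
  have "set_inv\<^bsub>integer_mod_group n\<^esub> X = (\<lambda>x. int n - x) ` X"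
    unfolding SET_INV_def using inv by auto
  also have "\<dots> = {x. int n - x \<in> X}" by (force simp: image_iff)
  finally show ?thesis .
qed

text \<open>
  A coincidence \<open>z = x + y - n\<close> modulo \<open>n\<close> becomes \<open>n - z = (n - x) + (n - y)\<close>, so for symmetric
  sets of representatives sum-freeness over the integers suffices.
\<close>

lemma symmetric_complete_sum_free_from_representatives:
  assumes X: "X \<subseteq> {0<..<int n}"
    and reflect: "\<And>x. int n - x \<in> X \<longleftrightarrow> x \<in> X"
    and free: "\<And>x y. x \<in> X \<Longrightarrow> y \<in> X \<Longrightarrow> x + y \<notin> X"
    and complete: "\<And>z. \<lbrakk>0 \<le> z; z < int n; z \<notin> X\<rbrakk> \<Longrightarrow>
      \<exists>x\<in>X. \<exists>y\<in>X. z = x + y \<or> z = x + y - int n"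
    and n: "0 < n"
  shows "X \<subseteq> carrier (integer_mod_group n) \<and> symmetric_subset (integer_mod_group n) X
    \<and> complete_subset (integer_mod_group n) X \<and> sum_free (integer_mod_group n) X"
proof (intro conjI)
  show "X \<subseteq> carrier (integer_mod_group n)"
    using X n by (auto simp: carrier_integer_mod_group)
  show "symmetric_subset (integer_mod_group n) X"
    unfolding symmetric_subset_def set_inv_integer_mod_group[OF X] by (simp add: reflect)
  have sumset: "X <#>\<^bsub>integer_mod_group n\<^esub> X = {(x + y) mod int n | x y. x \<in> X \<and> y \<in> X}"
    unfolding set_mult_def by auto
  show "complete_subset (integer_mod_group n) X"
    unfolding complete_subset_def
  proof
    fix z assume "z \<in> carrier (integer_mod_group n) - X"
    then have z: "0 \<le> z" "z < int n" "z \<notin> X" using n by (auto simp: carrier_integer_mod_group)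
    then obtain x y where xy: "x \<in> X" "y \<in> X" "z = x + y \<or> z = x + y - int n"
      using complete by blast
    have "z = (x + y) mod int n"
    proof (cases "z = x + y")
      case False
      then have "x + y = z + int n" using xy by simp
      then show ?thesis using z by simp
    qed (use z in simp)
    then show "z \<in> X <#>\<^bsub>integer_mod_group n\<^esub> X" using xy sumset by blast
  qed
  show "sum_free (integer_mod_group n) X"
    unfolding sum_free_def
  proof (rule equals0I)
    fix z assume "z \<in> X \<inter> (X <#>\<^bsub>integer_mod_group n\<^esub> X)"
    then obtain x y where xyz: "x \<in> X" "y \<in> X" "(x + y) mod int n \<in> X"
      using sumset by auto
    then have bounds: "0 < x" "x < int n" "0 < y" "y < int n" using X by auto
    show False
    proof (cases "x + y < int n")
      case True
      then show False using xyz bounds free by simp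
    next
      case False
      then have "(x + y) mod int n = (x + y - int n) mod int n" by (simp add: mod_diff_right_eq)
      also have "\<dots> = x + y - int n" using False bounds by (intro mod_pos_pos_trivial) auto
      finally have "int n - ((int n - x) + (int n - y)) \<in> X" using xyz by simp
      then show False using reflect free xyz by blast
    qed
  qed
qed

lemma arithmetic_progression_shift:
  fixes c d k :: int
  shows "{c + 2 * d - 2 + i * d | i. 0 \<le> i \<and> i \<le> k - 4} = {x. x - (c - 2) \<in> (\<lambda>q. q * d) ` {2..k - 2}}"
    (is "?L = ?R")
proof
  show "?L \<subseteq> ?R"
  proof
    fix x assume "x \<in> ?L"
    then obtain i where "0 \<le> i" "i \<le> k - 4" "x = c + 2 * d - 2 + i * d" by blast
    then show "x \<in> ?R" by (auto simp: image_iff algebra_simps intro!: bexI[of _ "i + 2"])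
  qed
  show "?R \<subseteq> ?L"
  proof
    fix x assume "x \<in> ?R"
    then obtain q where "2 \<le> q" "q \<le> k - 2" "x - (c - 2) = q * d" by auto
    then have "x = c + 2 * d - 2 + (q - 2) * d \<and> 0 \<le> q - 2 \<and> q - 2 \<le> k - 4"
      by (auto simp: algebra_simps)
    then show "x \<in> ?L" by blast
  qed
qed

theorem theorem4p1:
  fixes t d k :: int and n :: nat
  assumes "t \<ge> 1" and "d \<ge> 2" and "k \<ge> 4"
    and "int n \<in> {4 * d * k + 6 * t - 11, 4 * d * k + 6 * t - 14}"
    and "int (card (set_C n t)) \<ge> d"
  shows "set_S n t d k \<subseteq> carrier (integer_mod_group n)
    \<and> symmetric_subset (integer_mod_group n) (set_S n t d k)
    \<and> complete_subset (integer_mod_group n) (set_S n t d k)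
    \<and> sum_free (integer_mod_group n) (set_S n t d k)"
proof -
  define a w where "a = start n t" and "w = int (card (set_C n t))"
  have w_eq: "w = (if even n then 2 * t + 1 else 2 * t + 2)"
    using card_set_C[OF assms(1-4)] by (simp add: w_def)
  define m where "m = k * d"
  from assms(4) consider "int n = 4 * m + 6 * t - 11" | "int n = 4 * m + 6 * t - 14"
    by (auto simp: m_def)
  then have "a = m + w - 4 \<and> int n = 4 * a - w - 1 \<and>
      int n div 2 - t = 2 * a - w \<and> (int n + 1) div 2 + t = 2 * a - 1"
  proof cases
    case 1
    then have "odd (int n)" "int n div 2 = 2 * m + 3 * t - 6" "(int n + 1) div 2 = 2 * m + 3 * t - 5"
      by presburger+
    moreover from this have "a = m + 2 * t - 2" "w = 2 * t + 2"
      unfolding a_def start_def ceiling_half w_eq by simp_all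
    ultimately show ?thesis using 1 by simp
  next
    case 2
    then have "even (int n)" "int n div 2 = 2 * m + 3 * t - 7" "(int n + 1) div 2 = 2 * m + 3 * t - 7"
      by presburger+
    moreover from this have "a = m + 2 * t - 3" "w = 2 * t + 1"
      unfolding a_def start_def ceiling_half w_eq by simp_all
    ultimately show ?thesis using 2 by simp
  qed
  then have a: "a = k * d + w - 4" and n: "int n = 4 * a - w - 1"
    and C: "\<lfloor>real n / 2\<rfloor> - t = 2 * a - w" "\<lceil>real n / 2\<rceil> + t = 2 * a - 1"
    unfolding m_def floor_half ceiling_half by auto
  interpret skeleton_set d k w a "int n"
    using assms a n by unfold_locales (auto simp: w_def)

  define P where "P = {a..a + d - 2}"
  define Q where "Q = {a + 2 * d - 2 + i * d | i. 0 \<le> i \<and> i \<le> k - 4}"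
  have left: "left_part = P \<union> Q"
    unfolding P_def Q_def arithmetic_progression_shift left_part_def skeleton_def by auto
  have PQ: "P \<subseteq> {0<..<int n}" "Q \<subseteq> {0<..<int n}" and mid: "middle \<subseteq> {0<..<int n}"
    using reps_subset left unfolding reps_def by auto
  have "set_S n t d k = reps"
    unfolding set_S_def set_A_def set_B_def set_C_def plus_minus_def C
      a_def[symmetric] P_def[symmetric] Q_def[symmetric] middle_def[symmetric]
      reduce_mod_id[OF PQ(1)] reduce_mod_id[OF PQ(2)] reduce_mod_id[OF mid]
      set_inv_integer_mod_group[OF PQ(1)] set_inv_integer_mod_group[OF PQ(2)]
    unfolding reps_def left by auto
  moreover have "0 < int n" using n kd a w d by linarith
  then have "0 < n" by simp
  moreover have "\<exists>x\<in>reps. \<exists>y\<in>reps. z = x + y \<or> z = x + y - int n"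
    if "0 \<le> z" "z < int n" "z \<notin> reps" for z
    using reps_complete[OF that] by blast
  ultimately show ?thesis
    using symmetric_complete_sum_free_from_representatives
      [OF reps_subset reps_reflect reps_sum_free] by simp
qed

end
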